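(* Let $r\geq 1$ be an integer and let $G=\{[a\rightarrow a\,;\,b\rightarrow b],\ [a\rightarrow a^rb\,;\,b\rightarrow a^{r-1}b^2]\}$ be the context-free matrix grammar with first component $g_1=[a\rightarrow a\,;\,b\rightarrow b]$ and second component $g_2=[a\rightarrow a^rb\,;\,b\rightarrow a^{r-1}b^2]$. Let $D_1,D_2$ be the formal derivative operators with respect to $g_1,g_2$, and let $D_{12}=D_1\circ D_2$, $D_{21}=D_2\circ D_1$. Then for all $n\geq 0$: 1. $D^n_{12}(a)=(nr+1)!_r\,((n-1)r+1)!_r\,a^{nr-(n-1)}b^n$. 2. $D^n_{21}(a)=\bigl(((n-1)r+1)!_r\bigr)^2a^{nr-(n-1)}b^n$. 3. $D^n_{12}(b)=(nr+1)!_r\,((n-1)r+1)!_r\,a^{nr-n}b^{n+1}$. 4. $D^n_{21}(b)=\bigl(((n-1)r+1)!_r\bigr)^2a^{nr-n}b^{n+1}$.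
   Context: The letters $a,b$ are independent commutative indeterminates. Formal functions over $\{a,b\}$ are defined recursively: letters are formal functions; sums and products of formal functions are formal functions; $f(u)$ is a formal function if $f$ is analytic and $u$ is a formal function; all formal functions arise in finitely many such steps. A context-free matrix grammar $\{g_1,\dots,g_s\}$ is a collection of context-free grammars, where each $g_i$ is a set of productions $c\rightarrow w$ replacing a letter $c$ by a formal function $w$. The operator $D_i$ is the formal derivative with respect to $g_i$: $D_i(c)=w$ if $c\rightarrow w$ is a production of $g_i$, $D_i(c)=0$ for other letters $c$, and $D_i$ is extended to formal functions by $D_i(u+v)=D_i(u)+D_i(v)$, $D_i(uv)=D_i(u)v+uD_i(v)$ and $D_i(f(u))=\frac{\partial f(u)}{\partial u}D_i(u)$ for $f$ analytic. Moreover $D_{ik}(u)=D_i(D_k(u))$, $D_{ik}^0(u)=u$ and $D_{ik}^{n+1}(u)=D_{ik}(D_{ik}^n(u))$. For an integer $r\geq 1$, the multifactorial numbers $n!_r$ are defined for integers $n\geq 1-r$ by the initial values $(1-r)!_r=\cdots=(-1)!_r=0!_r=1$ and the recurrence $n!_r=n\,(n-r)!_r$ for $n\geq 1$. *)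

theory Defs
  imports "HOL-Complex_Analysis.Complex_Analysis"
begin

datatype letter = A | B

datatype formal_fun =
    Letter letter
  | Sum formal_fun formal_fun
  | Prod formal_fun formal_fun
  | App "complex \<Rightarrow> complex" formal_fun

text \<open>
  A constant is a constant analytic function applied to some formal function; the argument chosen
  here is irrelevant.
\<close>

definition const :: "complex \<Rightarrow> formal_fun"
  where "const c = App (\<lambda>_. c) (Letter A)"

text \<open>With these instances \<open>u ^ n\<close> is the \<open>n\<close>-fold product of \<open>u\<close>, and \<open>u ^ 0\<close> is \<open>const 1\<close>.\<close>

instantiation formal_fun :: "{plus, times, one, power}"
begin
definition plus_formal_fun where "u + v = Sum u v"
definition times_formal_fun where "u * v = Prod u v"
definition one_formal_fun where "1 = const 1"
instance ..
end

text \<open>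
  Two expressions denote the same formal function if they are equal as functions of the two
  independent variables. Analytic functions such as \<open>1 / z\<close> or \<open>Ln z\<close> are not entire, so this is
  relative to an open set \<open>\<Omega>\<close> of values for the pair of letters, on which all the analytic functions
  that occur have to be analytic at the values of their arguments.
\<close>

primrec eval :: "formal_fun \<Rightarrow> complex \<times> complex \<Rightarrow> complex"
  where
    "eval (Letter c) p = (case c of A \<Rightarrow> fst p | B \<Rightarrow> snd p)"
  | "eval (Sum u v) p = eval u p + eval v p"
  | "eval (Prod u v) p = eval u p * eval v p"
  | "eval (App f u) p = f (eval u p)"

primrec formal_on :: "(complex \<times> complex) set \<Rightarrow> formal_fun \<Rightarrow> bool"
  where
    "formal_on \<Omega> (Letter c) \<longleftrightarrow> True"
  | "formal_on \<Omega> (Sum u v) \<longleftrightarrow> formal_on \<Omega> u \<and> formal_on \<Omega> v"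
  | "formal_on \<Omega> (Prod u v) \<longleftrightarrow> formal_on \<Omega> u \<and> formal_on \<Omega> v"
  | "formal_on \<Omega> (App f u) \<longleftrightarrow> formal_on \<Omega> u \<and> f analytic_on (eval u ` \<Omega>)"

definition formal_eq :: "formal_fun \<Rightarrow> (complex \<times> complex) set \<Rightarrow> formal_fun \<Rightarrow> bool"
    ("(_ \<doteq>[_] _)" [51, 0, 51] 50)
  where "u \<doteq>[\<Omega>] v \<longleftrightarrow> formal_on \<Omega> u \<and> formal_on \<Omega> v \<and> (\<forall>p\<in>\<Omega>. eval u p = eval v p)"

text \<open>\<open>g c = None\<close> means that \<open>g\<close> has no production for the letter \<open>c\<close>.\<close>

type_synonym grammar = "letter \<Rightarrow> formal_fun option"

type_synonym matrix_grammar = "grammar list"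

primrec formal_derivative :: "grammar \<Rightarrow> formal_fun \<Rightarrow> formal_fun"
  where
    "formal_derivative g (Letter c) = (case g c of Some w \<Rightarrow> w | None \<Rightarrow> const 0)"
  | "formal_derivative g (Sum u v) = Sum (formal_derivative g u) (formal_derivative g v)"
  | "formal_derivative g (Prod u v) =
       Sum (Prod (formal_derivative g u) v) (Prod u (formal_derivative g v))"
  | "formal_derivative g (App f u) = Prod (App (deriv f) u) (formal_derivative g u)"

text \<open>The components of a matrix grammar are numbered from 1.\<close>

definition D :: "matrix_grammar \<Rightarrow> nat \<Rightarrow> formal_fun \<Rightarrow> formal_fun"
  where "D G i = formal_derivative (G ! (i - 1))"

definition DD :: "matrix_grammar \<Rightarrow> nat \<Rightarrow> nat \<Rightarrow> formal_fun \<Rightarrow> formal_fun"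
  where "DD G i k = D G i \<circ> D G k"

text \<open>
  The formal derivative is defined by recursion on expressions. It maps formal functions to
  formal functions and does not depend on the expression by which a formal function is represented.
\<close>

lemma formal_on_const [simp]: "formal_on \<Omega> (const c)"
  by (simp add: const_def)

lemma formal_on_formal_derivative:
  assumes "formal_on \<Omega> u" and "\<And>c w. g c = Some w \<Longrightarrow> formal_on \<Omega> w"
  shows "formal_on \<Omega> (formal_derivative g u)"
  using assms(1)
  by (induction u) (auto simp: assms(2) analytic_deriv split: option.split)

lemma eval_formal_derivative:
  fixes g :: grammar
  assumes "formal_on \<Omega> u" and p: "p \<in> \<Omega>"
  defines "h \<equiv> \<lambda>c. eval (formal_derivative g (Letter c)) p"
  shows "((\<lambda>t. eval u (fst p + t * h A, snd p + t * h B))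
           has_field_derivative eval (formal_derivative g u) p) (at 0)"
  using assms(1)
proof (induction u)
  case (Letter c)
  show ?case
    by (cases c) (auto intro!: derivative_eq_intros simp: h_def)
next
  case (App f u)
  have "f analytic_on {eval u p}"
    using App.prems p by (auto intro: analytic_on_subset)
  then have "(f has_field_derivative deriv f (eval u p)) (at (eval u p))"
    by (simp add: analytic_on_imp_differentiable_at DERIV_deriv_iff_field_differentiable)
  then show ?case
    using DERIV_chain2[of f _ "\<lambda>t. eval u (fst p + t * h A, snd p + t * h B)" 0] App by simp
qed (auto intro!: derivative_eq_intros)

lemma formal_derivative_cong:
  assumes "open \<Omega>" and uv: "u \<doteq>[\<Omega>] v" and "\<And>c w. g c = Some w \<Longrightarrow> formal_on \<Omega> w"
  shows "formal_derivative g u \<doteq>[\<Omega>] formal_derivative g v"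
proof -
  have "eval (formal_derivative g u) p = eval (formal_derivative g v) p" if p: "p \<in> \<Omega>" for p
  proof -
    define h where "h = (\<lambda>c. eval (formal_derivative g (Letter c)) p)"
    define l where "l = (\<lambda>t. (fst p + t * h A, snd p + t * h B))"
    have "open (l -` \<Omega>)"
      unfolding l_def by (intro open_vimage \<open>open \<Omega>\<close> continuous_intros)
    moreover have "0 \<in> l -` \<Omega>"
      using p by (simp add: l_def)
    moreover have "((\<lambda>t. eval u (l t)) has_field_derivative eval (formal_derivative g u) p) (at 0)"
      and v: "((\<lambda>t. eval v (l t)) has_field_derivative eval (formal_derivative g v) p) (at 0)"
      using eval_formal_derivative[OF _ p] uv by (auto simp: l_def h_def formal_eq_def)
    ultimately have "((\<lambda>t. eval v (l t)) has_field_derivative eval (formal_derivative g u) p) (at 0)"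
      using uv by (auto simp: formal_eq_def intro: has_field_derivative_transform_within_open)
    with v show ?thesis
      by (rule DERIV_unique[symmetric])
  qed
  then show ?thesis
    using assms by (auto simp: formal_eq_def formal_on_formal_derivative)
qed

abbreviation a :: formal_fun where "a \<equiv> Letter A"
abbreviation b :: formal_fun where "b \<equiv> Letter B"

definition G :: "nat \<Rightarrow> matrix_grammar"
  where "G r = [[A \<mapsto> a, B \<mapsto> b], [A \<mapsto> a ^ r * b, B \<mapsto> a ^ (r - 1) * b ^ 2]]"

text \<open>
  The multifactorial \<open>n!\<^sub>r\<close> for \<open>r \<ge> 1\<close> and \<open>n \<ge> 1 - r\<close>. The values for \<open>r = 0\<close> and for \<open>n < 1 - r\<close>
  have no meaning.
\<close>

function multifact :: "nat \<Rightarrow> int \<Rightarrow> int"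
  where "multifact r n = (if r = 0 \<or> n \<le> 0 then 1 else n * multifact r (n - int r))"
  by auto
termination by (relation "Wellfounded.measure (\<lambda>(r, n). nat n)") auto

declare multifact.simps [simp del]

end

theory Submission
  imports Defs
begin

text \<open>
  Both productions of \<open>g\<^sub>1\<close> and of \<open>g\<^sub>2\<close> multiply their letter by the same factor, which is \<open>1\<close> for \<open>g\<^sub>1\<close> and
  \<open>a\<^bsup>r-1\<^esup>b\<close> for \<open>g\<^sub>2\<close>. A derivation that multiplies both letters by \<open>w\<close> multiplies a monomial of total
  degree \<open>d\<close> by \<open>d w\<close>, as in Euler's identity for homogeneous functions
  (\<open>eval_formal_derivative_monomial\<close>). Hence \<open>D\<^sub>1\<close> multiplies such a monomial by \<open>d\<close>, and \<open>D\<^sub>2\<close>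
  multiplies it by \<open>d a\<^bsup>r-1\<^esup>b\<close>, which raises the degree by \<open>r\<close>. In \<open>D\<^sub>1\<^sub>2\<close> the operator \<open>D\<^sub>1\<close> acts after the
  degree has been raised, so \<open>D\<^sub>1\<^sub>2\<close> contributes the factor \<open>d (d + r)\<close>; in \<open>D\<^sub>2\<^sub>1\<close> it acts before, and the
  factor is \<open>d\<^sup>2\<close>.

  A letter has degree \<open>1\<close>, so \<open>n\<close> steps lead to degree \<open>n r + 1\<close>, and the collected factors are
  products of numbers in the progression \<open>1, r + 1, 2 r + 1, \<dots>\<close>. These are the multifactorials
  (\<open>multifact_progression\<close>). The letter enters only through its exponents, so \<open>a\<close> and \<open>b\<close>
  are treated together (\<open>DD_12_funpow\<close>, \<open>DD_21_funpow\<close>).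

  The expression that results from one derivation is a sum of products, not literally a monomial.
  By \<open>formal_derivative_cong\<close> it may be replaced by the monomial that it denotes before the next
  derivation is applied.
\<close>

section \<open>Monomials\<close>

definition monomial :: "int \<Rightarrow> nat \<Rightarrow> nat \<Rightarrow> formal_fun"
  where "monomial c i j = const (of_int c) * a ^ i * b ^ j"

lemma eval_const [simp]: "eval (const c) p = c"
  by (simp add: const_def)

lemma eval_times [simp]: "eval (u * v) p = eval u p * eval v p"
  by (simp add: times_formal_fun_def)

lemma eval_power [simp]: "eval (u ^ n) p = eval u p ^ n"
  by (induction n) (simp_all add: one_formal_fun_def)

lemma formal_on_times [simp]: "formal_on \<Omega> (u * v) \<longleftrightarrow> formal_on \<Omega> u \<and> formal_on \<Omega> v"
  by (simp add: times_formal_fun_def)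

lemma formal_on_power: "formal_on \<Omega> u \<Longrightarrow> formal_on \<Omega> (u ^ n)"
  by (induction n) (simp_all add: one_formal_fun_def)

lemma formal_on_monomial [simp]: "formal_on \<Omega> (monomial c i j)"
  by (simp add: monomial_def formal_on_power)

lemma eval_monomial: "eval (monomial c i j) p = of_int c * fst p ^ i * snd p ^ j"
  by (simp add: monomial_def)

lemma letter_eq_monomial: "a \<doteq>[\<Omega>] monomial 1 1 0" "b \<doteq>[\<Omega>] monomial 1 0 1"
  by (simp_all add: formal_eq_def eval_monomial)

lemma formal_eq_trans: "u \<doteq>[\<Omega>] v \<Longrightarrow> v \<doteq>[\<Omega>] w \<Longrightarrow> u \<doteq>[\<Omega>] w"
  by (simp add: formal_eq_def)

section \<open>Derivatives of monomials\<close>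

lemma eval_formal_derivative_const: "eval (formal_derivative g (const c)) p = 0"
  by (simp add: const_def)

text \<open>
  Where \<open>u\<close> does not vanish, \<open>w\<close> is the value of its logarithmic derivative, and logarithmic
  derivatives add up in products. Stated without division, this also covers the zeros of \<open>u\<close>.
\<close>

lemma eval_formal_derivative_power:
  assumes "eval (formal_derivative g u) p = w * eval u p"
  shows "eval (formal_derivative g (u ^ n)) p = of_nat n * w * eval u p ^ n"
proof (induction n)
  case 0
  show ?case
    by (simp add: one_formal_fun_def eval_formal_derivative_const)
next
  case (Suc n)
  have "eval (formal_derivative g (u ^ Suc n)) p
      = eval (formal_derivative g u) p * eval u p ^ n
        + eval u p * eval (formal_derivative g (u ^ n)) p"
    by (simp add: times_formal_fun_def)
  then show ?case
    by (simp add: assms Suc.IH algebra_simps)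
qed

lemma eval_formal_derivative_monomial:
  assumes "eval (formal_derivative g a) p = w * fst p"
    and "eval (formal_derivative g b) p = w * snd p"
  shows "eval (formal_derivative g (monomial c i j)) p = of_nat (i + j) * w * eval (monomial c i j) p"
proof -
  have "eval (formal_derivative g (a ^ i)) p = of_nat i * w * fst p ^ i"
    using eval_formal_derivative_power[of g a p w i] assms(1) by simp
  moreover have "eval (formal_derivative g (b ^ j)) p = of_nat j * w * snd p ^ j"
    using eval_formal_derivative_power[of g b p w j] assms(2) by simp
  moreover have "eval (formal_derivative g (monomial c i j)) p
      = of_int c * (eval (formal_derivative g (a ^ i)) p * snd p ^ j
                    + fst p ^ i * eval (formal_derivative g (b ^ j)) p)"
    unfolding monomial_def times_formal_fun_def
    by (simp add: eval_formal_derivative_const algebra_simps)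
  ultimately show ?thesis
    by (simp add: eval_monomial algebra_simps)
qed

section \<open>The two components of the grammar\<close>

lemma D_1_monomial:
  assumes "open \<Omega>" and u: "u \<doteq>[\<Omega>] monomial c i j"
  shows "D (G r) 1 u \<doteq>[\<Omega>] monomial (c * int (i + j)) i j"
proof -
  let ?g = "[A \<mapsto> a, B \<mapsto> b] :: grammar"
  have on: "formal_on \<Omega> w" if "?g l = Some w" for l w
    using that by (cases l) auto
  have "formal_derivative ?g (monomial c i j) \<doteq>[\<Omega>] monomial (c * int (i + j)) i j"
    using formal_on_formal_derivative[of \<Omega> "monomial c i j" ?g, OF formal_on_monomial on]
    by (simp add: formal_eq_def eval_monomial eval_formal_derivative_monomial[where w = 1])
  with formal_derivative_cong[OF assms on] have "formal_derivative ?g u \<doteq>[\<Omega>] monomial (c * int (i + j)) i j"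
    by (rule formal_eq_trans)
  then show ?thesis
    by (simp add: D_def G_def)
qed

lemma D_2_monomial:
  assumes "r \<ge> 1" and "open \<Omega>" and u: "u \<doteq>[\<Omega>] monomial c i j"
  shows "D (G r) 2 u \<doteq>[\<Omega>] monomial (c * int (i + j)) (i + (r - 1)) (j + 1)"
proof -
  let ?g = "[A \<mapsto> a ^ r * b, B \<mapsto> a ^ (r - 1) * b ^ 2] :: grammar"
  have on: "formal_on \<Omega> w" if "?g l = Some w" for l w
    using that by (cases l) (auto simp: formal_on_power)
  have "eval (formal_derivative ?g (monomial c i j)) p
      = of_nat (i + j) * (fst p ^ (r - 1) * snd p) * eval (monomial c i j) p" for p
  proof (rule eval_formal_derivative_monomial)
    have "fst p ^ r = fst p ^ (r - 1) * fst p"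
      using \<open>r \<ge> 1\<close> by (simp add: power_eq_if)
    then show "eval (formal_derivative ?g a) p = fst p ^ (r - 1) * snd p * fst p"
      by simp
  qed (simp add: power2_eq_square)
  then have "formal_derivative ?g (monomial c i j) \<doteq>[\<Omega>] monomial (c * int (i + j)) (i + (r - 1)) (j + 1)"
    using formal_on_formal_derivative[of \<Omega> "monomial c i j" ?g, OF formal_on_monomial on]
    by (simp add: formal_eq_def eval_monomial power_add)
  with formal_derivative_cong[OF assms(2,3) on]
  have "formal_derivative ?g u \<doteq>[\<Omega>] monomial (c * int (i + j)) (i + (r - 1)) (j + 1)"
    by (rule formal_eq_trans)
  then show ?thesis
    by (simp add: D_def G_def)
qed

lemma DD_12_monomial:
  assumes "r \<ge> 1" and "open \<Omega>" and "u \<doteq>[\<Omega>] monomial c i j"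
  shows "DD (G r) 1 2 u \<doteq>[\<Omega>] monomial (c * int (i + j) * int (i + j + r)) (i + (r - 1)) (j + 1)"
proof -
  have "i + (r - 1) + (j + 1) = i + j + r"
    using \<open>r \<ge> 1\<close> by simp
  with D_1_monomial[OF assms(2) D_2_monomial[OF assms]] show ?thesis
    unfolding DD_def o_apply by metis
qed

lemma DD_21_monomial:
  assumes "r \<ge> 1" and "open \<Omega>" and "u \<doteq>[\<Omega>] monomial c i j"
  shows "DD (G r) 2 1 u \<doteq>[\<Omega>] monomial (c * int (i + j) ^ 2) (i + (r - 1)) (j + 1)"
  using D_2_monomial[OF assms(1,2) D_1_monomial[OF assms(2,3)]]
  unfolding DD_def o_apply power2_eq_square mult.assoc .

section \<open>Iterates on monomials of degree one\<close>

text \<open>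
  For \<open>n = 0\<close> the argument \<open>1 - r\<close> on the right is not positive, so the recurrence starts from
  the value \<open>1\<close> there.
\<close>

lemma multifact_progression:
  assumes "r \<ge> 1"
  shows "multifact r (int n * int r + 1) = (int n * int r + 1) * multifact r ((int n - 1) * int r + 1)"
proof -
  have "int n * int r + 1 > 0"
    by (simp add: add_nonneg_pos)
  with assms have "\<not> (r = 0 \<or> int n * int r + 1 \<le> 0)"
    by linarith
  then have "multifact r (int n * int r + 1)
      = (int n * int r + 1) * multifact r (int n * int r + 1 - int r)"
    by (rule trans[OF multifact.simps if_not_P])
  then show ?thesis
    by (simp add: algebra_simps)
qed

lemma multifact_progression_start: "r \<ge> 1 \<Longrightarrow> multifact r (1 - int r) = 1"
  by (subst multifact.simps) simp

lemma degree_iterate: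
  fixes r i j n :: nat
  assumes "r \<ge> 1" and "i + j = 1"
  shows "i + n * (r - 1) + (j + n) = n * r + 1"
proof -
  from \<open>r \<ge> 1\<close> obtain s where "r = Suc s"
    by (cases r) auto
  with \<open>i + j = 1\<close> show ?thesis
    by simp
qed

lemma DD_12_funpow:
  assumes r: "r \<ge> 1" and "open \<Omega>" and u: "u \<doteq>[\<Omega>] monomial 1 i j" and "i + j = 1"
  shows "(DD (G r) 1 2 ^^ n) u \<doteq>[\<Omega>]
    monomial (multifact r (int n * int r + 1) * multifact r ((int n - 1) * int r + 1))
      (i + n * (r - 1)) (j + n)"
proof (induction n)
  case 0
  show ?case
    using u multifact_progression[OF r, of 0] multifact_progression_start[OF r] by simp
next
  case (Suc n)
  let ?d = "i + n * (r - 1) + (j + n)"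
  let ?m = "\<lambda>n. multifact r (int n * int r + 1)"
  have "(DD (G r) 1 2 ^^ Suc n) u \<doteq>[\<Omega>]
      monomial (?m n * multifact r ((int n - 1) * int r + 1) * int ?d * int (?d + r))
        (i + n * (r - 1) + (r - 1)) (j + n + 1)"
    using DD_12_monomial[OF assms(1,2) Suc.IH] by simp
  moreover have "?m n * multifact r ((int n - 1) * int r + 1) * int ?d * int (?d + r)
      = ?m (Suc n) * ?m n"
    using multifact_progression[OF r, of n] multifact_progression[OF r, of "Suc n"]
    unfolding degree_iterate[OF r \<open>i + j = 1\<close>] by (simp add: algebra_simps)
  ultimately have "(DD (G r) 1 2 ^^ Suc n) u \<doteq>[\<Omega>]
      monomial (?m (Suc n) * ?m n) (i + n * (r - 1) + (r - 1)) (j + n + 1)"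
    by (simp only:)
  then show ?case
    by (simp add: ac_simps)
qed

lemma DD_21_funpow:
  assumes r: "r \<ge> 1" and "open \<Omega>" and u: "u \<doteq>[\<Omega>] monomial 1 i j" and "i + j = 1"
  shows "(DD (G r) 2 1 ^^ n) u \<doteq>[\<Omega>]
    monomial (multifact r ((int n - 1) * int r + 1) ^ 2) (i + n * (r - 1)) (j + n)"
proof (induction n)
  case 0
  show ?case
    using u multifact_progression_start[OF r] by simp
next
  case (Suc n)
  let ?d = "i + n * (r - 1) + (j + n)"
  have "(DD (G r) 2 1 ^^ Suc n) u \<doteq>[\<Omega>]
      monomial (multifact r ((int n - 1) * int r + 1) ^ 2 * int ?d ^ 2)
        (i + n * (r - 1) + (r - 1)) (j + n + 1)"
    using DD_21_monomial[OF assms(1,2) Suc.IH] by simp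
  moreover have "multifact r ((int n - 1) * int r + 1) ^ 2 * int ?d ^ 2
      = multifact r (int n * int r + 1) ^ 2"
    using multifact_progression[OF r, of n]
    unfolding degree_iterate[OF r \<open>i + j = 1\<close>] by (simp add: power_mult_distrib)
  ultimately show ?case
    by (simp add: ac_simps)
qed

theorem proposition4p1:
  fixes r n :: nat and \<Omega> :: "(complex \<times> complex) set"
  assumes "r \<ge> 1" and "open \<Omega>"
  shows "(DD (G r) 1 2 ^^ n) a \<doteq>[\<Omega>]
           const (of_int (multifact r (int n * int r + 1) * multifact r ((int n - 1) * int r + 1)))
             * a ^ nat (int n * int r - (int n - 1)) * b ^ n
       \<and> (DD (G r) 2 1 ^^ n) a \<doteq>[\<Omega>]
           const (of_int ((multifact r ((int n - 1) * int r + 1)) ^ 2))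
             * a ^ nat (int n * int r - (int n - 1)) * b ^ n
       \<and> (DD (G r) 1 2 ^^ n) b \<doteq>[\<Omega>]
           const (of_int (multifact r (int n * int r + 1) * multifact r ((int n - 1) * int r + 1)))
             * a ^ nat (int n * int r - int n) * b ^ (n + 1)
       \<and> (DD (G r) 2 1 ^^ n) b \<doteq>[\<Omega>]
           const (of_int ((multifact r ((int n - 1) * int r + 1)) ^ 2))
             * a ^ nat (int n * int r - int n) * b ^ (n + 1)"
proof -
  have "int n * int r - (int n - 1) = int (1 + n * (r - 1))"
    "int n * int r - int n = int (0 + n * (r - 1))"
    using \<open>r \<ge> 1\<close> by (simp_all add: of_nat_diff algebra_simps)
  then have exps: "nat (int n * int r - (int n - 1)) = 1 + n * (r - 1)"
    "nat (int n * int r - int n) = 0 + n * (r - 1)"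
    by (simp_all only: nat_int)
  note deg1 = letter_eq_monomial[of \<Omega>]
  show ?thesis
    using DD_12_funpow[OF assms deg1(1), of n] DD_21_funpow[OF assms deg1(1), of n]
      DD_12_funpow[OF assms deg1(2), of n] DD_21_funpow[OF assms deg1(2), of n]
    unfolding exps monomial_def by (simp add: add.commute[of 1 n])
qed

end
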